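(* Let $a,b,J$ be positive integers with $J\ge 3$, and suppose that $H(a,J) \geq aJ+1$. If $\{A_i \mid 1 \leq i \leq a\}$ is a set of $a$ pairwise disjoint Golomb rulers, each being a $J$-element subset of $\{1, \dots, H(a,J)\}$, and there is a gap of size $w$ in the union $\bigcup_{i=1}^{a} A_i$, then $$H(a+b,J) \leq H(a,J) + H(b,J) - w$$ and $$H(2a,J) \leq 2H(a,J) - 2w.$$
   Context: A Golomb ruler is a set $\{a_1,\dots,a_k\}$ of $k$ distinct non-negative integers such that all the differences $a_i-a_j$, $i\neq j$, are distinct. An $(I,J,n)$-DGR is a set of $I$ pairwise disjoint Golomb rulers, each being a $J$-element subset of $\{1,2,\dots,n\}$. For positive integers $I,J$, $H(I,J)$ is the least positive integer $n$ such that there is an $(I,J,n)$-DGR. A gap of size $w$ ($w$ a positive integer) in a subset $U$ of $\{1,\dots,n\}$ is a set of $w$ consecutive integers $\{t+1,\dots,t+w\}\subseteq\{1,\dots,n\}$ containing no element of $U$; here $n=H(a,J)$. *)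

theory Defs
  imports "HOL-Library.Disjoint_Sets"
begin

(* Differences are taken in the integers, over ordered pairs of distinct marks. *)
definition golomb_ruler :: "nat set \<Rightarrow> bool" where
  "golomb_ruler S \<longleftrightarrow>
     finite S \<and> inj_on (\<lambda>(x, y). int x - int y) {(x, y). x \<in> S \<and> y \<in> S \<and> x \<noteq> y}"

definition is_DGR :: "nat \<Rightarrow> nat \<Rightarrow> nat \<Rightarrow> nat set set \<Rightarrow> bool" where
  "is_DGR I J n \<R> \<longleftrightarrow>
     finite \<R> \<and> card \<R> = I \<and> disjoint \<R> \<and>
     (\<forall>R\<in>\<R>. golomb_ruler R \<and> card R = J \<and> R \<subseteq> {1..n})"

(* Only meant for positive I and J, where some n always qualifies: for instance, cut the
   powers of 2 below 2 ^ (I * J) into I blocks of J elements. *)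
definition H :: "nat \<Rightarrow> nat \<Rightarrow> nat" where
  "H I J = (LEAST n. n > 0 \<and> (\<exists>\<R>. is_DGR I J n \<R>))"

(* The gap need not be maximal. *)
definition has_gap :: "nat \<Rightarrow> nat set \<Rightarrow> nat \<Rightarrow> bool" where
  "has_gap n U w \<longleftrightarrow>
     w > 0 \<and> (\<exists>t. {t + 1..t + w} \<subseteq> {1..n} \<and> {t + 1..t + w} \<inter> U = {})"

end

theory Submission
  imports Defs
begin

text \<open>
  Let \<open>n = H a J\<close>, \<open>m = H b J\<close>, and let the gap be \<open>{t+1..t+w}\<close>.  A map \<open>\<phi>\<close> carries disjoint Golomb
  rulers to disjoint Golomb rulers as soon as \<open>\<phi> x + \<phi> v = \<phi> u + \<phi> y\<close> forces \<open>x + v = u + y\<close>.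

  For the second inequality, \<open>x\<close> is sent to \<open>2x\<close> below the gap and to \<open>2x - 2w - 1\<close> above it: an
  unwanted coincidence is excluded by parity if it involves an odd number of upper marks, and by
  the size of the gap if two upper marks face two lower ones.  The unused positions are filled by
  a second copy, sent to \<open>2x - 1\<close> and \<open>2x - 2w\<close>.

  For the first inequality, note that \<open>w < m\<close>, since otherwise the \<open>b\<close> rulers would fit into the gap.
  If \<open>m\<close> is at least the length of both sides of the gap, widen the gap to \<open>m\<close> and put the \<open>b\<close>
  rulers there.  Otherwise one side is longer than \<open>m\<close>; put the \<open>b\<close> rulers beyond that side, with
  the \<open>w\<close> positions nearest to it carried across it into the gap.  Either way, the parts into
  which a ruler is split lie too far apart for a new coincidence of differences.
\<close>

section \<open>Golomb rulers under maps that reflect sums\<close>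

lemma golomb_ruler_iff:
  "golomb_ruler S \<longleftrightarrow>
     finite S \<and> (\<forall>x\<in>S. \<forall>y\<in>S. \<forall>u\<in>S. \<forall>v\<in>S. x + v = u + y \<longrightarrow> x \<noteq> y \<longrightarrow> x = u \<and> y = v)"
  (is "_ \<longleftrightarrow> finite S \<and> ?sums")
proof -
  let ?P = "{(x, y). x \<in> S \<and> y \<in> S \<and> x \<noteq> y}" and ?d = "\<lambda>(x, y). int x - int y"
  have "?sums" if inj: "inj_on ?d ?P"
  proof (intro ballI impI)
    fix x y u v assume "x \<in> S" "y \<in> S" "u \<in> S" "v \<in> S" "x + v = u + y" "x \<noteq> y"
    then have "?d (x, y) = ?d (u, v)" "(x, y) \<in> ?P" "(u, v) \<in> ?P"
      by auto
    from inj_onD[OF inj this] show "x = u \<and> y = v"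
      by simp
  qed
  moreover have "inj_on ?d ?P" if sums: ?sums
  proof (rule inj_onI, clarify)
    fix x y u v assume "x \<in> S" "y \<in> S" "u \<in> S" "v \<in> S" "x \<noteq> y" "int x - int y = int u - int v"
    moreover from this have "x + v = u + y"
      by linarith
    ultimately show "x = u \<and> y = v"
      using sums by blast
  qed
  ultimately show ?thesis
    unfolding golomb_ruler_def by blast
qed

text \<open>Equivalently, \<open>\<phi>\<close> is injective on \<open>U\<close> and its inverse is
  a Freiman homomorphism of order 2. Imposed on the union of a family, it also keeps the images of
  different rulers disjoint.\<close>

definition reflects_sums :: "(nat \<Rightarrow> nat) \<Rightarrow> nat set \<Rightarrow> bool" where
  "reflects_sums \<phi> U \<longleftrightarrow>
     (\<forall>x\<in>U. \<forall>y\<in>U. \<forall>u\<in>U. \<forall>v\<in>U. \<phi> x + \<phi> v = \<phi> u + \<phi> y \<longrightarrow> x + v = u + y)"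

lemma reflects_sums_inj_on:
  assumes "reflects_sums \<phi> U"
  shows "inj_on \<phi> U"
  using assms unfolding reflects_sums_def inj_on_def by (metis add_right_cancel)

lemma golomb_ruler_image:
  assumes "golomb_ruler S" "reflects_sums \<phi> S"
  shows "golomb_ruler (\<phi> ` S)"
  using assms unfolding golomb_ruler_iff reflects_sums_def
  by (smt (verit, ccfv_threshold) finite_imageI image_iff)

lemma reflects_sums_subset:
  "reflects_sums \<phi> U \<Longrightarrow> V \<subseteq> U \<Longrightarrow> reflects_sums \<phi> V"
  unfolding reflects_sums_def by blast

lemma is_DGR_Union_subset: "is_DGR I J n R \<Longrightarrow> \<Union>R \<subseteq> {1..n}"
  unfolding is_DGR_def by blast

lemma is_DGR_image:
  assumes R: "is_DGR I J n R" and \<phi>: "reflects_sums \<phi> (\<Union>R)" and sub: "\<phi> ` \<Union>R \<subseteq> {1..k}"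
  shows "is_DGR I J k ((`) \<phi> ` R)"
proof -
  have inj: "inj_on \<phi> (\<Union>R)"
    by (rule reflects_sums_inj_on[OF \<phi>])
  have "inj_on ((`) \<phi>) R"
    using inj by (auto simp: inj_on_def dest!: inj_on_image_eq_iff[OF inj, THEN iffD1, rotated 2])
  then have "card ((`) \<phi> ` R) = I"
    using R by (simp add: card_image is_DGR_def)
  moreover have "disjoint ((`) \<phi> ` R)"
    using disjoint_image[OF inj] R by (simp add: is_DGR_def)
  moreover have "golomb_ruler (\<phi> ` S) \<and> card (\<phi> ` S) = J \<and> \<phi> ` S \<subseteq> {1..k}" if "S \<in> R" for S
  proof -
    have S: "golomb_ruler S" "card S = J" "S \<subseteq> \<Union>R"
      using R that by (auto simp: is_DGR_def)
    show ?thesis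
      using golomb_ruler_image[OF S(1) reflects_sums_subset[OF \<phi> S(3)]] S(2)
        card_image[OF inj_on_subset[OF inj S(3)]] S(3) sub by auto
  qed
  ultimately show ?thesis
    using R by (simp add: is_DGR_def)
qed

lemma is_DGR_union:
  assumes R: "is_DGR I J n R" and Q: "is_DGR K J n Q"
    and disj: "\<Union>R \<inter> \<Union>Q = {}" and "J > 0"
  shows "is_DGR (I + K) J n (R \<union> Q)"
proof -
  \<comment> \<open>Disjoint unions leave only the empty set as a possible common member.\<close>
  have "S \<noteq> {}" if "S \<in> R" for S
    using R \<open>J > 0\<close> that by (force simp: is_DGR_def)
  then have "R \<inter> Q = {}"
    using disj by blast
  moreover have "disjoint (R \<union> Q)"
    using R Q disj by (intro disjoint_union) (simp_all add: is_DGR_def)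
  ultimately show ?thesis
    using R Q unfolding is_DGR_def by (simp add: card_Un_disjoint ball_Un)
qed

lemma is_DGR_subset:
  assumes "is_DGR I J n R" "Q \<subseteq> R" "\<Union>Q \<subseteq> {1..k}"
  shows "is_DGR (card Q) J k Q"
  using assms unfolding is_DGR_def
  by (meson Union_upper order.trans pairwise_subset finite_subset subsetD)

lemma is_DGR_pos:
  assumes "is_DGR I J n R" "I > 0" "J > 0"
  shows "n \<ge> J"
proof -
  obtain S where "S \<in> R"
    using assms by (metis card.empty is_DGR_def equals0I less_irrefl)
  then have "card S = J" "S \<subseteq> {1..n}"
    using assms(1) by (auto simp: is_DGR_def)
  then show ?thesis
    using card_mono[of "{1..n}" S] by simp
qed

section \<open>The minimal length \<open>H\<close>\<close>

lemma H_le: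
  assumes "is_DGR I J n R" "I > 0" "J > 0"
  shows "H I J \<le> n"
  unfolding H_def using is_DGR_pos[OF assms] assms by (intro Least_le) auto

text \<open>Ensures that some length admits \<open>b\<close> rulers, so that a least one exists:
  copies of a single ruler are laid side by side in blocks of length \<open>n\<close>.\<close>

lemma is_DGR_translates:
  assumes "is_DGR 1 J n R" "J > 0"
  shows "\<exists>Q. is_DGR b J (b * n) Q"
proof (induction b)
  case 0
  have "is_DGR 0 J (0 * n) {}"
    by (simp add: is_DGR_def)
  then show ?case ..
next
  case (Suc b)
  then obtain Q where Q: "is_DGR b J (b * n) Q" ..
  then have Q': "is_DGR b J (Suc b * n) Q"
    by (fastforce simp: is_DGR_def)
  have R: "is_DGR 1 J (Suc b * n) ((`) (\<lambda>x. b * n + x) ` R)"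
    by (rule is_DGR_image[OF assms(1)])
      (use is_DGR_Union_subset[OF assms(1)] in \<open>fastforce simp: reflects_sums_def\<close>)+
  have "\<Union>Q \<inter> \<Union>((`) (\<lambda>x. b * n + x) ` R) = {}"
    using is_DGR_Union_subset[OF Q] is_DGR_Union_subset[OF assms(1)] by fastforce
  then show ?case
    using is_DGR_union[OF Q' R _ assms(2)] by auto
qed

lemma H_attained:
  assumes "is_DGR a J n R" "a > 0" "b > 0" "J > 0"
  shows "\<exists>Q. is_DGR b J (H b J) Q"
proof -
  obtain S where "S \<in> R"
    using assms by (metis card.empty is_DGR_def equals0I less_irrefl)
  then have "is_DGR (card {S}) J n {S}"
    using is_DGR_Union_subset[OF assms(1)] by (intro is_DGR_subset[OF assms(1)]) auto
  then obtain Q where Q: "is_DGR b J (b * n) Q"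
    using is_DGR_translates assms(4) by (metis card_1_singleton_iff One_nat_def)
  then have "b * n > 0 \<and> (\<exists>Q. is_DGR b J (b * n) Q)"
    using is_DGR_pos[OF assms(1,2,4)] Q assms(3,4) by auto
  then show ?thesis
    unfolding H_def by (rule LeastI2) blast
qed

text \<open>By disjointness at most one ruler contains \<open>n\<close>. Without it, at least
  \<open>a\<close> rulers remain, all inside \<open>{1..n - 1}\<close>.\<close>

lemma H_less:
  assumes R: "is_DGR (a + b) J n R" and "a > 0" "b > 0" "J > 0"
  shows "H a J < n"
proof -
  define Q where "Q = {S \<in> R. n \<notin> S}"
  have fin: "finite R" and cardR: "card R = a + b" and disj: "disjoint R"
    using R by (auto simp: is_DGR_def)
  have "card (R - Q) \<le> 1"
    unfolding card_le_Suc0_iff_eq[OF finite_Diff[OF fin], of Q, folded One_nat_def]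
    using disj by (auto simp: Q_def dest: disjointD)
  moreover have "card (R - Q) = card R - card Q"
    using fin by (intro card_Diff_subset) (auto simp: Q_def)
  ultimately have "a \<le> card Q"
    using cardR \<open>b > 0\<close> by linarith
  then obtain Q' where Q': "Q' \<subseteq> Q" "card Q' = a"
    by (meson obtain_subset_with_card_n)
  have "\<Union>Q' \<subseteq> {1..n - 1}"
  proof
    fix x assume "x \<in> \<Union>Q'"
    then obtain S where "S \<in> R" "n \<notin> S" "x \<in> S"
      using Q'(1) by (auto simp: Q_def)
    then have "x \<in> {1..n}" "x \<noteq> n"
      using is_DGR_Union_subset[OF R] by blast+
    then show "x \<in> {1..n - 1}"
      by auto
  qed
  moreover have "Q' \<subseteq> R"
    using Q'(1) by (auto simp: Q_def)
  ultimately have "is_DGR a J (n - 1) Q'"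
    using is_DGR_subset[OF R] Q'(2) by blast
  then have "H a J \<le> n - 1"
    using assms by (intro H_le)
  moreover have "n \<ge> J"
    using is_DGR_pos[OF R] assms by simp
  ultimately show ?thesis
    using \<open>J > 0\<close> by linarith
qed

section \<open>Shifting all marks above a threshold\<close>

text \<open>An unwanted coincidence has more marks above \<open>t\<close> on one side. One against
  none forces \<open>t \<ge> s + w + 2\<close>, two against one forces
  \<open>n \<ge> t + 2 * w + s + 2\<close>, and two against none is impossible.\<close>

lemma reflects_sums_stretch:
  assumes "U \<subseteq> {1..n}" "U \<inter> {t + 1..t + w} = {}" "t \<le> s + w" "n \<le> t + 2 * w + s"
  shows "reflects_sums (\<lambda>x. if x \<le> t then c + x else c + x + s) U"
proof -
  define f where "f = (\<lambda>x. if x \<le> t then c + x else c + x + s)"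
  have U: "1 \<le> x" "x \<le> n" "x \<le> t \<and> f x = c + x \<or> t + w < x \<and> f x = c + x + s"
    if "x \<in> U" for x
    using assms(1,2) that by (force simp: disjoint_iff f_def)+
  have "reflects_sums f U"
    unfolding reflects_sums_def
  proof (intro ballI impI)
    fix x y u v
    assume *: "x \<in> U" "y \<in> U" "u \<in> U" "v \<in> U" and "f x + f v = f u + f y"
    then show "x + v = u + y"
      using U[OF *(1)] U[OF *(2)] U[OF *(3)] U[OF *(4)] assms(3,4)
      by - (elim disjE conjE; linarith)
  qed
  then show ?thesis
    by (simp add: f_def)
qed

section \<open>Doubling, with the two sides of the gap separated by parity\<close>

text \<open>The values \<open>d = 0\<close> and \<open>d = 1\<close> give the two copies. For these,
  no subtraction truncates at a positive mark outside the gap.\<close>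

definition fold_gap :: "nat \<Rightarrow> nat \<Rightarrow> nat \<Rightarrow> nat \<Rightarrow> nat" where
  "fold_gap t w d x = (if x \<le> t then 2 * x - d else 2 * x + d - (2 * w + 1))"

lemma fold_gap_cases:
  assumes "0 < x" "x \<le> t \<or> t + w < x" "d \<le> 1"
  shows "x \<le> t \<and> fold_gap t w d x + d = 2 * x \<or>
    t + w < x \<and> fold_gap t w d x + 2 * w + 1 = 2 * x + d"
  using assms by (auto simp: fold_gap_def)

lemma even_fold_gap:
  assumes "0 < x" "x \<le> t \<or> t + w < x" "d \<le> 1"
  shows "even (fold_gap t w d x + d) \<longleftrightarrow> x \<le> t"
  using fold_gap_cases[OF assms]
proof (elim disjE conjE)
  assume "t + w < x" "fold_gap t w d x + 2 * w + 1 = 2 * x + d"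
  then have "fold_gap t w d x + d + (2 * w + 1) = 2 * (x + d)"
    by simp
  then have "even (fold_gap t w d x + d + (2 * w + 1))"
    by (metis dvd_triv_left)
  then show ?thesis
    using \<open>t + w < x\<close> by simp
qed simp

lemma reflects_sums_fold_gap:
  assumes U: "\<And>x. x \<in> U \<Longrightarrow> 0 < x \<and> (x \<le> t \<or> t + w < x)" and "d \<le> 1"
  shows "reflects_sums (fold_gap t w d) U"
  unfolding reflects_sums_def
proof (intro ballI impI)
  fix x y u v
  assume *: "x \<in> U" "y \<in> U" "u \<in> U" "v \<in> U"
    and eq: "fold_gap t w d x + fold_gap t w d v = fold_gap t w d u + fold_gap t w d y"
  have F: "z \<le> t \<and> fold_gap t w d z + d = 2 * z \<or>
      t + w < z \<and> fold_gap t w d z + 2 * w + 1 = 2 * z + d" if "z \<in> U" for z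
    using fold_gap_cases U[OF that] assms(2) by blast
  have "even (fold_gap t w d z) \<longleftrightarrow> (even d \<longleftrightarrow> z \<le> t)" if "z \<in> U" for z
    using even_fold_gap U[OF that] assms(2) by (metis even_add)
  then have "((x \<le> t) = (v \<le> t)) = ((u \<le> t) = (y \<le> t))"
    using arg_cong[OF eq, of even] * by (simp only: even_add) argo
  \<comment> \<open>The number of upper marks is even. In the last two cases the equation makes the
    two sums differ by \<open>2 * w + 1 - 2 * d\<close>, but the gap makes them differ by at least
    \<open>2 * w + 2\<close>.\<close>
  then consider
      "(x \<le> t) = (u \<le> t)" "(v \<le> t) = (y \<le> t)" | "(x \<le> t) = (y \<le> t)" "(v \<le> t) = (u \<le> t)"
    | "x \<le> t" "v \<le> t" "t < u" "t < y" | "t < x" "t < v" "u \<le> t" "y \<le> t"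
    by linarith
  then show "x + v = u + y"
    using F[OF *(1)] F[OF *(2)] F[OF *(3)] F[OF *(4)] eq assms(2)
    by cases (elim disjE conjE; linarith)+
qed

lemma H_double_le:
  assumes R: "is_DGR a J n R" and "a > 0" "J > 0"
    and gap: "\<Union>R \<inter> {t + 1..t + w} = {}" "t + w \<le> n"
  shows "H (2 * a) J \<le> 2 * n - 2 * w"
proof -
  let ?f = "fold_gap t w"
  have U: "0 < x" "x \<le> n" "x \<le> t \<or> t + w < x" if "x \<in> \<Union>R" for x
    using is_DGR_Union_subset[OF R] gap(1) that by (force simp: disjoint_iff)+
  have F: "x \<le> t \<and> ?f d x + d = 2 * x \<or> t + w < x \<and> ?f d x + 2 * w + 1 = 2 * x + d"
    if "x \<in> \<Union>R" "d \<le> 1" for x d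
    using fold_gap_cases U(1,3)[OF that(1)] that(2) by blast
  have D: "is_DGR a J (2 * n - 2 * w) ((`) (?f d) ` R)" if "d \<le> 1" for d
  proof (rule is_DGR_image[OF R])
    show "reflects_sums (?f d) (\<Union>R)"
      using U(1,3) that by (intro reflects_sums_fold_gap) blast+
    have "1 \<le> ?f d x \<and> ?f d x \<le> 2 * n - 2 * w" if "x \<in> \<Union>R" for x
      using F[OF that \<open>d \<le> 1\<close>] U(1,2)[OF that] \<open>d \<le> 1\<close> gap(2)
      by - (elim disjE conjE; linarith)
    then show "?f d ` \<Union>R \<subseteq> {1..2 * n - 2 * w}"
      unfolding image_subset_iff atLeastAtMost_iff by blast
  qed
  \<comment> \<open>At equal values parity puts \<open>x\<close> and \<open>y\<close> on opposite
    sides of the gap; they would then differ by exactly \<open>w\<close>, which is too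
    little.\<close>
  have "?f 0 x \<noteq> ?f 1 y" if "x \<in> \<Union>R" "y \<in> \<Union>R" for x y
  proof
    assume "?f 0 x = ?f 1 y"
    moreover from this have "x \<le> t \<longleftrightarrow> t < y"
      using even_fold_gap[OF U(1,3)[OF that(1)], of 0] even_fold_gap[OF U(1,3)[OF that(2)], of 1]
      by auto
    ultimately show False
      using F[OF that(1), of 0] F[OF that(2), of 1] by auto
  qed
  then have "\<Union>((`) (?f 0) ` R) \<inter> \<Union>((`) (?f 1) ` R) = {}"
    by blast
  then have "is_DGR (a + a) J (2 * n - 2 * w) ((`) (?f 0) ` R \<union> (`) (?f 1) ` R)"
    by (intro is_DGR_union D \<open>J > 0\<close>) auto
  then show ?thesis
    using assms by (intro H_le) (simp_all add: mult_2)
qed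

section \<open>Placing \<open>b\<close> further rulers\<close>

lemma is_DGR_merge:
  assumes R: "is_DGR a J n R" and Q: "is_DGR b J m Q" and "J > 0"
    and \<phi>: "reflects_sums \<phi> (\<Union>R)" and \<psi>: "reflects_sums \<psi> (\<Union>Q)"
    and "\<And>x. x \<in> \<Union>R \<Longrightarrow> 1 \<le> \<phi> x \<and> \<phi> x \<le> k" and "\<And>x. x \<in> \<Union>Q \<Longrightarrow> 1 \<le> \<psi> x \<and> \<psi> x \<le> k"
    and "\<And>x y. x \<in> \<Union>R \<Longrightarrow> y \<in> \<Union>Q \<Longrightarrow> \<phi> x \<noteq> \<psi> y"
  shows "\<exists>P. is_DGR (a + b) J k P"
proof -
  have "is_DGR a J k ((`) \<phi> ` R)"
    using assms(6) by (intro is_DGR_image[OF R \<phi>]) (simp add: image_subset_iff)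
  moreover have "is_DGR b J k ((`) \<psi> ` Q)"
    using assms(7) by (intro is_DGR_image[OF Q \<psi>]) (simp add: image_subset_iff)
  moreover have "\<Union>((`) \<phi> ` R) \<inter> \<Union>((`) \<psi> ` Q) = {}"
    using assms(8) by blast
  ultimately show ?thesis
    using is_DGR_union[OF _ _ _ \<open>J > 0\<close>] by (intro exI)
qed

lemma H_add_le:
  assumes R: "is_DGR a J (H a J) R" and Q: "is_DGR b J m Q" and "a > 0" "b > 0" "J > 0"
    and gap: "\<Union>R \<inter> {t + 1..t + w} = {}" "t + w \<le> H a J"
  shows "H (a + b) J \<le> H a J + m - w"
proof -
  define n where "n = H a J"
  note R = R[folded n_def] and tw = gap(2)[folded n_def]
  have U: "1 \<le> x" "x \<le> n" "x \<le> t \<or> t + w < x" if "x \<in> \<Union>R" for x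
    using is_DGR_Union_subset[OF R] gap(1) that by (force simp: disjoint_iff)+
  have V: "1 \<le> y" "y \<le> m" if "y \<in> \<Union>Q" for y
    using is_DGR_Union_subset[OF Q] that by force+
  have translate: "reflects_sums (\<lambda>x. c + x) W" for c W
    by (simp add: reflects_sums_def)
  have "w < m"
  proof (rule ccontr)
    assume "\<not> w < m"
    have "\<exists>P. is_DGR (a + b) J n P"
    proof (rule is_DGR_merge[OF R Q \<open>J > 0\<close> translate translate])
      \<comment> \<open>Writing \<open>0 + x\<close> keeps the identity an instance of
        \<open>translate\<close>.\<close>
      show "1 \<le> 0 + x \<and> 0 + x \<le> n" if "x \<in> \<Union>R" for x
        using U[OF that] by simp
      show "1 \<le> t + y \<and> t + y \<le> n" if "y \<in> \<Union>Q" for y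
        using V[OF that] tw \<open>\<not> w < m\<close> by linarith
      show "0 + x \<noteq> t + y" if "x \<in> \<Union>R" "y \<in> \<Union>Q" for x y
        using U[OF that(1)] V[OF that(2)] \<open>\<not> w < m\<close> by linarith
    qed
    \<comment> \<open>As \<open>n\<close> is least for \<open>a\<close> rulers, it cannot hold
      \<open>a + b\<close> of them.\<close>
    then show False
      using H_less[of a b J n] assms n_def by blast
  qed
  consider "t \<le> m" "n - t - w \<le> m" | "m < t" | "m < n - t - w"
    by linarith
  then have "\<exists>P. is_DGR (a + b) J (n + m - w) P"
  proof cases
    case 1
    \<comment> \<open>With \<open>s = m - w\<close>, the conditions of
      \<open>reflects_sums_stretch\<close> become the two bounds of this case.\<close>
    let ?\<phi> = "\<lambda>x. if x \<le> t then 0 + x else 0 + x + (m - w)"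
    show ?thesis
    proof (rule is_DGR_merge[OF R Q \<open>J > 0\<close> _ translate])
      show "reflects_sums ?\<phi> (\<Union>R)"
        using 1 \<open>w < m\<close> by (intro reflects_sums_stretch[OF is_DGR_Union_subset[OF R] gap(1)]) linarith+
      show "1 \<le> ?\<phi> x \<and> ?\<phi> x \<le> n + m - w" if "x \<in> \<Union>R" for x
        using U[OF that] \<open>w < m\<close> tw by auto
      show "1 \<le> t + y \<and> t + y \<le> n + m - w" if "y \<in> \<Union>Q" for y
        using V[OF that] tw by linarith
      show "?\<phi> x \<noteq> t + y" if "x \<in> \<Union>R" "y \<in> \<Union>Q" for x y
        using U[OF that(1)] V[OF that(2)] \<open>w < m\<close> by (simp; linarith)
    qed
  next
    case 2
    \<comment> \<open>The top \<open>w\<close> positions of \<open>Q\<close> jump over the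
      \<open>t\<close> lower positions of \<open>R\<close> into its gap. No gap in \<open>Q\<close>
      is required, because the jump \<open>t\<close> exceeds \<open>m\<close>.\<close>
    let ?\<psi> = "\<lambda>y. if y \<le> m - w then 0 + y else 0 + y + t"
    show ?thesis
    proof (rule is_DGR_merge[OF R Q \<open>J > 0\<close> translate])
      show "reflects_sums ?\<psi> (\<Union>Q)"
        using 2 by (intro reflects_sums_stretch[OF is_DGR_Union_subset[OF Q], where w = 0]) auto
      show "1 \<le> (m - w) + x \<and> (m - w) + x \<le> n + m - w" if "x \<in> \<Union>R" for x
        using U[OF that] \<open>w < m\<close> by linarith
      show "1 \<le> ?\<psi> y \<and> ?\<psi> y \<le> n + m - w" if "y \<in> \<Union>Q" for y
        using V[OF that] tw \<open>w < m\<close> by auto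
      show "(m - w) + x \<noteq> ?\<psi> y" if "x \<in> \<Union>R" "y \<in> \<Union>Q" for x y
        using U[OF that(1)] V[OF that(2)] \<open>w < m\<close> by (simp; linarith)
    qed
  next
    case 3
    \<comment> \<open>Mirror image: the bottom \<open>w\<close> positions of \<open>Q\<close> go
      into the gap, the others beyond \<open>n\<close>.\<close>
    let ?\<psi> = "\<lambda>y. if y \<le> w then t + y else t + y + (n - t - w)"
    show ?thesis
    proof (rule is_DGR_merge[OF R Q \<open>J > 0\<close> translate])
      show "reflects_sums ?\<psi> (\<Union>Q)"
        using 3 \<open>w < m\<close>
        by (intro reflects_sums_stretch[OF is_DGR_Union_subset[OF Q], where w = 0]) auto
      show "1 \<le> 0 + x \<and> 0 + x \<le> n + m - w" if "x \<in> \<Union>R" for x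
        using U[OF that] \<open>w < m\<close> by linarith
      show "1 \<le> ?\<psi> y \<and> ?\<psi> y \<le> n + m - w" if "y \<in> \<Union>Q" for y
        using V[OF that] tw \<open>w < m\<close> by auto
      show "0 + x \<noteq> ?\<psi> y" if "x \<in> \<Union>R" "y \<in> \<Union>Q" for x y
        using U[OF that(1)] V[OF that(2)] tw by (simp; linarith)
    qed
  qed
  then show ?thesis
    using H_le assms n_def by (metis add_gr_0)
qed

theorem theorem5:
  fixes a b J w :: nat and A :: "nat \<Rightarrow> nat set"
  assumes "a > 0" and "b > 0" and "J \<ge> 3"
    and "H a J \<ge> a * J + 1"
    and "is_DGR a J (H a J) (A ` {1..a})"
    and "has_gap (H a J) (\<Union>i\<in>{1..a}. A i) w"
  shows "int (H (a + b) J) \<le> int (H a J) + int (H b J) - int w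
       \<and> int (H (2 * a) J) \<le> 2 * int (H a J) - 2 * int w"
proof -
  have J: "J > 0"
    using assms(3) by simp
  obtain t where "w > 0" "{t + 1..t + w} \<subseteq> {1..H a J}"
      and gap: "\<Union>(A ` {1..a}) \<inter> {t + 1..t + w} = {}"
    using assms(6) unfolding has_gap_def by auto
  then have tw: "t + w \<le> H a J"
    by (simp add: subset_iff)
  obtain Q where "is_DGR b J (H b J) Q"
    using H_attained[OF assms(5,1,2) J] ..
  from H_add_le[OF assms(5) this assms(1,2) J gap tw] H_double_le[OF assms(5,1) J gap tw]
  show ?thesis
    \<comment> \<open>The bound \<open>w \<le> H a J\<close> keeps the natural subtractions from
      truncating.\<close>
    using tw by linarith
qed

end
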